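(* For every positive integer $n$, $$E_0(n)=E_1(n)=\frac{\overline{p}_o(n)}{2}.$$
   Context: A two-color partition of $n$ is a finite multiset of positive integers (parts), each part carrying one of the two colors red or blue, whose numerical values sum to $n$; copies of the same integer in different colors are regarded as different parts. Let $\mathcal E(n)$ be the set of two-color partitions of $n$ in which parts are distinct (each colored part occurs at most once, so an odd integer may occur once in red and once in blue) and even parts may occur only in blue. Equivalently, $\sum_{n\ge0}|\mathcal E(n)|q^n=\prod_{k\ge1}(1+q^{2k-1})^2(1+q^{2k})$. For $\lambda\in\mathcal E(n)$, let $r(\lambda)$ be the number of red odd parts of $\lambda$. Define $\mathcal E_0(n)=\{\lambda\in\mathcal E(n): r(\lambda)\equiv 0\pmod 2\}$ and $\mathcal E_1(n)=\{\lambda\in\mathcal E(n): r(\lambda)\equiv 1\pmod 2\}$, and let $E_i(n)=|\mathcal E_i(n)|$ for $i=0,1$. An overpartition of $n$ is a partition of $n$ in which the first occurrence of each distinct part may be overlined. $\overline p_o(n)$ denotes the number of overpartitions of $n$ into odd parts, i.e. those in which the overlined parts are distinct odd integers and the non-overlined parts are unrestricted odd integers; $\sum_{n\ge0}\overline p_o(n)q^n=\prod_{k\ge1}\frac{1+q^{2k-1}}{1-q^{2k-1}}$. *)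

theory Defs
  imports Complex_Main "HOL-Library.Multiset"
begin

datatype color = Red | Blue

text \<open>The part \<open>(k, c)\<close> is the integer \<open>k\<close> in the color \<open>c\<close>, so copies of the same
  integer in different colors are different parts.\<close>

definition two_color_partitions :: "nat \<Rightarrow> (nat \<times> color) multiset set" where
  "two_color_partitions n =
     {p. (\<forall>x \<in># p. fst x > 0) \<and> (\<Sum>x \<in># p. fst x) = n}"

definition EE :: "nat \<Rightarrow> (nat \<times> color) multiset set" where
  "EE n = {p \<in> two_color_partitions n.
             (\<forall>x. count p x \<le> 1) \<and> (\<forall>x \<in># p. even (fst x) \<longrightarrow> snd x = Blue)}"

definition red_odd_parts :: "(nat \<times> color) multiset \<Rightarrow> nat" where
  "red_odd_parts p = size {#x \<in># p. odd (fst x) \<and> snd x = Red#}"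

definition EE0 :: "nat \<Rightarrow> (nat \<times> color) multiset set" where
  "EE0 n = {p \<in> EE n. red_odd_parts p mod 2 = 0}"

definition EE1 :: "nat \<Rightarrow> (nat \<times> color) multiset set" where
  "EE1 n = {p \<in> EE n. red_odd_parts p mod 2 = 1}"

definition E0 :: "nat \<Rightarrow> nat" where
  "E0 n = card (EE0 n)"

definition E1 :: "nat \<Rightarrow> nat" where
  "E1 n = card (EE1 n)"

text \<open>The part \<open>(k, True)\<close> is an overlined \<open>k\<close> and \<open>(k, False)\<close> a non-overlined \<open>k\<close>.
  The occurrences of \<open>k\<close> in a multiset are not ordered, so the rule that only the first
  one may be overlined says that at most one of them is overlined.\<close>

definition overpartitions :: "nat \<Rightarrow> (nat \<times> bool) multiset set" where
  "overpartitions n =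
     {p. (\<forall>x \<in># p. fst x > 0) \<and> (\<Sum>x \<in># p. fst x) = n \<and> (\<forall>k. count p (k, True) \<le> 1)}"

definition overpartitions_odd :: "nat \<Rightarrow> (nat \<times> bool) multiset set" where
  "overpartitions_odd n = {p \<in> overpartitions n. \<forall>x \<in># p. odd (fst x)}"

definition p_bar_odd :: "nat \<Rightarrow> nat" where
  "p_bar_odd n = card (overpartitions_odd n)"

end

theory Submission
  imports Defs "HOL-Computational_Algebra.Formal_Power_Series"
begin

unbundle fps_syntax

text \<open>Euler's identity \<open>\<Prod>(1 - q\<^bsup>2k-1\<^esup>) \<cdot> \<Prod>(1 + q\<^sup>k) = 1\<close> does all the work.
  Counting \<open>\<E>(n)\<close> with the sign \<open>(-1)\<close> to the number of red odd parts gives the generating function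
  \<open>\<Prod>(1 - q\<^bsup>2k-1\<^esup>) \<cdot> \<Prod>(1 + q\<^sup>k)\<close>, so \<open>E\<^sub>0(n) = E\<^sub>1(n)\<close> for \<open>n > 0\<close>. Counting without signs gives
  \<open>\<Prod>(1 + q\<^bsup>2k-1\<^esup>) \<cdot> \<Prod>(1 + q\<^sup>k)\<close>, and Euler's identity turns the second factor into
  \<open>1 / \<Prod>(1 - q\<^bsup>2k-1\<^esup>)\<close>. To avoid infinite products, all parts are bounded by \<open>n\<close>, and the
  identity holds modulo \<open>q\<^bsup>n+1\<^esup>\<close>.\<close>

section \<open>Weighted generating functions of multisets\<close>

text \<open>Parts in \<open>D\<close> occur at most once, parts in \<open>U\<close> freely, so one
  product formula serves both families: \<open>U\<close> is empty for \<open>EE\<close>, while for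
  overpartitions \<open>D\<close> holds the overlined parts and \<open>U\<close> the others.\<close>

definition part_msets :: "('a \<Rightarrow> nat) \<Rightarrow> 'a set \<Rightarrow> 'a set \<Rightarrow> nat \<Rightarrow> 'a multiset set" where
  "part_msets w D U n =
     {p. set_mset p \<subseteq> D \<union> U \<and> (\<forall>x\<in>D. count p x \<le> 1) \<and> (\<Sum>x\<in>#p. w x) = n}"

definition part_gf :: "('a \<Rightarrow> nat) \<Rightarrow> ('a \<Rightarrow> 'r) \<Rightarrow> 'a set \<Rightarrow> 'a set \<Rightarrow> 'r::comm_ring_1 fps" where
  "part_gf w z D U = Abs_fps (\<lambda>n. \<Sum>p\<in>part_msets w D U n. \<Prod>x\<in>#p. z x)"

lemma size_le_sum_mset:
  fixes w :: "'a \<Rightarrow> nat"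
  assumes "\<And>x. x \<in># p \<Longrightarrow> w x > 0"
  shows "size p \<le> (\<Sum>x\<in>#p. w x)"
  using assms
proof (induction p)
  case (add x p)
  have "w x > 0" "size p \<le> (\<Sum>x\<in>#p. w x)"
    using add by auto
  then show ?case by simp
qed simp

text \<open>Positive weights bound the size of the multiset by \<open>n\<close>. Finiteness matters
  because a sum over an infinite set is 0 by convention, which would falsify the coefficients of
  \<open>part_gf\<close>.\<close>

lemma finite_part_msets:
  assumes "finite D" "finite U" "\<And>x. x \<in> D \<union> U \<Longrightarrow> w x > 0"
  shows "finite (part_msets w D U n)"
proof (rule finite_subset)
  show "part_msets w D U n \<subseteq> mset ` {xs. set xs \<subseteq> D \<union> U \<and> length xs \<le> n}"
  proof
    fix p assume p: "p \<in> part_msets w D U n"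
    obtain xs where xs: "p = mset xs" by (metis ex_mset)
    have "size p \<le> (\<Sum>x\<in>#p. w x)"
      using p assms(3) by (intro size_le_sum_mset) (auto simp: part_msets_def)
    then have "size p \<le> n"
      using p by (simp add: part_msets_def)
    with p xs show "p \<in> mset ` {xs. set xs \<subseteq> D \<union> U \<and> length xs \<le> n}"
      by (auto simp: part_msets_def)
  qed
  show "finite (mset ` {xs. set xs \<subseteq> D \<union> U \<and> length xs \<le> n})"
    using assms by (intro finite_imageI finite_lists_length_le) auto
qed

text \<open>Split by whether \<open>x\<close> occurs; once its only copy is removed, no
  \<open>x\<close> is left. The guard \<open>w x \<le> n\<close> is needed because subtraction on
  naturals truncates.\<close>

lemma part_msets_insert_once:
  assumes "x \<notin> D \<union> U"
  shows "part_msets w (insert x D) U n =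
    part_msets w D U n \<union> (if w x \<le> n then add_mset x ` part_msets w D U (n - w x) else {})"
    (is "?L = ?R")
proof
  show "?L \<subseteq> ?R"
  proof
    fix p assume p: "p \<in> ?L"
    show "p \<in> ?R"
    proof (cases "x \<in># p")
      case False
      then show ?thesis using p by (auto simp: part_msets_def)
    next
      case True
      then obtain q where q: "p = add_mset x q" by (meson mset_add)
      have "count q x = 0" using p q by (simp add: part_msets_def)
      then have "x \<notin># q" by (simp add: not_in_iff)
      then have "q \<in> part_msets w D U (n - w x)"
        using p q assms by (auto simp: part_msets_def split: if_splits)
      moreover have "w x \<le> n" using p q by (auto simp: part_msets_def)
      ultimately show ?thesis using q by auto
    qed
  qed
  have notin: "x \<notin># p" if "p \<in> part_msets w D U m" for p m
    using that assms by (auto simp: part_msets_def)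
  show "?R \<subseteq> ?L"
  proof
    fix p assume "p \<in> ?R"
    then consider "p \<in> part_msets w D U n"
      | q where "w x \<le> n" "q \<in> part_msets w D U (n - w x)" "p = add_mset x q"
      by (auto split: if_splits)
    then show "p \<in> ?L"
    proof cases
      case 1
      then show ?thesis using notin[OF 1] by (auto simp: part_msets_def not_in_iff)
    next
      case 2
      then show ?thesis using notin[OF 2(2)] assms by (auto simp: part_msets_def not_in_iff)
    qed
  qed
qed

text \<open>Removing one copy of \<open>x\<close> may leave others, so \<open>insert x U\<close>
  reappears on the right. This self-reference is what produces a denominator in the generating
  function.\<close>

lemma part_msets_insert_unrestricted:
  assumes "x \<notin> D \<union> U"
  shows "part_msets w D (insert x U) n =
    part_msets w D U n \<union>
      (if w x \<le> n then add_mset x ` part_msets w D (insert x U) (n - w x) else {})"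
    (is "?L = ?R")
proof
  show "?L \<subseteq> ?R"
  proof
    fix p assume p: "p \<in> ?L"
    show "p \<in> ?R"
    proof (cases "x \<in># p")
      case False
      then show ?thesis using p by (auto simp: part_msets_def)
    next
      case True
      then obtain q where q: "p = add_mset x q" by (meson mset_add)
      have "q \<in> part_msets w D (insert x U) (n - w x)"
        using p q assms by (force simp: part_msets_def split: if_splits)
      moreover have "w x \<le> n" using p q by (auto simp: part_msets_def)
      ultimately show ?thesis using q by auto
    qed
  qed
  show "?R \<subseteq> ?L"
    using assms by (auto simp: part_msets_def split: if_splits)
qed

lemma sum_prod_mset_union_add_mset:
  fixes z :: "'a \<Rightarrow> 'r::comm_ring_1"
  assumes "finite A" "finite B" "\<And>p. p \<in> A \<Longrightarrow> x \<notin># p"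
  shows "(\<Sum>p\<in>A \<union> (if P then add_mset x ` B else {}). \<Prod>x\<in>#p. z x) =
    (\<Sum>p\<in>A. \<Prod>x\<in>#p. z x) + (if P then z x * (\<Sum>p\<in>B. \<Prod>x\<in>#p. z x) else 0)"
proof (cases P)
  case True
  have "A \<inter> add_mset x ` B = {}" by (auto dest: assms(3))
  moreover have "inj_on (add_mset x) B" by (auto simp: inj_on_def)
  ultimately show ?thesis
    using assms True by (simp add: sum.union_disjoint sum.reindex sum_distrib_left)
qed simp

lemma part_gf_empty: "part_gf w z {} {} = 1"
proof -
  have "part_msets w {} {} n = (if n = 0 then {{#}} else {})" for n
    by (auto simp: part_msets_def)
  then show ?thesis by (simp add: part_gf_def fps_eq_iff)
qed

lemma part_gf_insert_once:
  assumes "finite D" "finite U" "\<And>y. y \<in> insert x (D \<union> U) \<Longrightarrow> w y > 0" "x \<notin> D \<union> U"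
  shows "part_gf w z (insert x D) U = part_gf w z D U * (1 + fps_const (z x) * fps_X ^ w x)"
proof -
  have fin: "finite (part_msets w D U n)" for n
    using assms by (intro finite_part_msets) auto
  have no: "x \<notin># p" if "p \<in> part_msets w D U n" for p n
    using that assms(4) by (auto simp: part_msets_def)
  have "part_gf w z (insert x D) U =
      part_gf w z D U + fps_const (z x) * (fps_X ^ w x * part_gf w z D U)"
    by (rule fps_ext)
      (simp add: part_gf_def part_msets_insert_once[OF assms(4)] fps_X_power_mult_nth
        sum_prod_mset_union_add_mset[OF fin fin no])
  then show ?thesis by (simp add: algebra_simps)
qed

text \<open>The recursion reads G = G' + z q^w G, where G allows \<open>x\<close> and G' does not.
  Collecting G on the left avoids inverses, so any commutative ring will do.\<close>

lemma part_gf_insert_unrestricted: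
  assumes "finite D" "finite U" "\<And>y. y \<in> insert x (D \<union> U) \<Longrightarrow> w y > 0" "x \<notin> D \<union> U"
  shows "part_gf w z D (insert x U) * (1 - fps_const (z x) * fps_X ^ w x) = part_gf w z D U"
proof -
  have fin: "finite (part_msets w D U n)" "finite (part_msets w D (insert x U) n)" for n
    using assms by (auto intro!: finite_part_msets)
  have no: "x \<notin># p" if "p \<in> part_msets w D U n" for p n
    using that assms(4) by (auto simp: part_msets_def)
  have "part_gf w z D (insert x U) $ n =
      (part_gf w z D U + fps_const (z x) * (fps_X ^ w x * part_gf w z D (insert x U))) $ n" for n
    unfolding part_gf_def fps_nth_Abs_fps
    by (subst part_msets_insert_unrestricted[OF assms(4)])
      (simp add: fps_X_power_mult_nth sum_prod_mset_union_add_mset[OF fin no])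
  then have "part_gf w z D (insert x U) =
      part_gf w z D U + fps_const (z x) * (fps_X ^ w x * part_gf w z D (insert x U))"
    by (rule fps_ext)
  then show ?thesis by (simp add: algebra_simps)
qed

text \<open>The elements of \<open>D\<close> are inserted first, while \<open>U\<close> is empty,
  each giving a factor on the right; each element of \<open>U\<close> inserted afterwards cancels
  against its own factor on the left.\<close>

lemma part_gf_product:
  assumes "finite D" "finite U" "D \<inter> U = {}" "\<And>x. x \<in> D \<union> U \<Longrightarrow> w x > 0"
  shows "part_gf w z D U * (\<Prod>x\<in>U. 1 - fps_const (z x) * fps_X ^ w x) =
    (\<Prod>x\<in>D. 1 + fps_const (z x) * fps_X ^ w x)"
  using assms(2-4)
proof (induction U rule: finite_induct)
  case empty
  from assms(1) empty.prems show ?case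
  proof (induction D rule: finite_induct)
    case (insert x D)
    then show ?case
      using part_gf_insert_once[of D "{}" x w z] by (simp add: mult.commute)
  qed (simp add: part_gf_empty)
next
  case (insert x U)
  have "part_gf w z D (insert x U) * (\<Prod>x\<in>insert x U. 1 - fps_const (z x) * fps_X ^ w x) =
      (part_gf w z D (insert x U) * (1 - fps_const (z x) * fps_X ^ w x)) *
        (\<Prod>x\<in>U. 1 - fps_const (z x) * fps_X ^ w x)"
    using insert.hyps by (simp add: mult.assoc)
  also have "part_gf w z D (insert x U) * (1 - fps_const (z x) * fps_X ^ w x) = part_gf w z D U"
    using insert.hyps insert.prems assms(1) by (intro part_gf_insert_unrestricted) auto
  also have "part_gf w z D U * (\<Prod>x\<in>U. 1 - fps_const (z x) * fps_X ^ w x) =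
      (\<Prod>x\<in>D. 1 + fps_const (z x) * fps_X ^ w x)"
    using insert.prems by (intro insert.IH) auto
  finally show ?case .
qed

section \<open>Euler's identity modulo a power of \<open>q\<close>\<close>

text \<open>Every factor is 1 modulo q^(n+1); the cofactor \<open>Q\<close> spells out this
  congruence.\<close>

lemma prod_one_minus_X_cong_one:
  assumes "\<And>k. k \<in> K \<Longrightarrow> n < k"
  shows "\<exists>Q :: 'r::comm_ring_1 fps. (\<Prod>k\<in>K. 1 - fps_X ^ k) = 1 + fps_X ^ Suc n * Q"
  using assms
proof (induction K rule: infinite_finite_induct)
  case (insert k K)
  then obtain Q :: "'r fps" where Q: "(\<Prod>k\<in>K. 1 - fps_X ^ k) = 1 + fps_X ^ Suc n * Q"
    by auto
  have "Suc n \<le> k" using insert.prems by (simp add: Suc_leI)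
  then have k: "fps_X ^ k = fps_X ^ Suc n * (fps_X :: 'r fps) ^ (k - Suc n)"
    by (metis le_add_diff_inverse power_add)
  have "(\<Prod>k\<in>insert k K. 1 - fps_X ^ k) = (1 - fps_X ^ k) * (1 + fps_X ^ Suc n * Q)"
    using insert.hyps Q by simp
  also have "\<dots> = 1 + fps_X ^ Suc n * (Q - fps_X ^ (k - Suc n) * (1 + fps_X ^ Suc n * Q))"
    unfolding k by (simp add: algebra_simps del: power_Suc)
  finally show ?case by blast
\<comment> \<open>A product over an infinite set is 1 by convention, so \<open>Q = 0\<close> settles
  that case along with the empty one.\<close>
qed (auto intro: exI[of _ 0])

text \<open>Multiply by \<open>\<Prod>(1 - q\<^sup>k)\<close> over the even \<open>k \<le> n\<close>: both sides become \<open>\<Prod>(1 - q\<^bsup>2k\<^esup>)\<close> over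
  \<open>k \<le> n\<close>.\<close>

lemma euler_finite:
  "(\<Prod>k\<in>{k\<in>{1..n}. odd k}. 1 - fps_X ^ k) * (\<Prod>k\<in>{1..n}. 1 + fps_X ^ k) =
    (\<Prod>k\<in>{k\<in>{n<..2*n}. even k}. 1 - fps_X ^ k :: 'r::idom fps)"
proof -
  let ?f = "\<lambda>k. 1 - fps_X ^ k :: 'r fps"
  let ?E = "{k\<in>{1..n}. even k}" and ?O = "{k\<in>{1..n}. odd k}" and ?L = "{k\<in>{n<..2*n}. even k}"
  have split: "prod ?f {1..n} = prod ?f ?E * prod ?f ?O"
    by (subst prod.union_disjoint[symmetric]) (auto intro!: prod.cong)
  \<comment> \<open>The even numbers up to 2n are cut at \<open>n\<close>: the lower ones will
    cancel, the upper ones form the right-hand side.\<close>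
  have dbl: "(\<lambda>k. 2 * k) ` {1..n} = ?E \<union> ?L"
    by (auto elim!: evenE)
  have "prod ?f ?E * (prod ?f ?O * (\<Prod>k\<in>{1..n}. 1 + fps_X ^ k)) =
      (\<Prod>k\<in>{1..n}. ?f k * (1 + fps_X ^ k))"
    by (simp only: split prod.distrib mult.assoc)
  also have "\<dots> = (\<Prod>k\<in>{1..n}. ?f (2 * k))"
    by (intro prod.cong) (simp_all add: distrib_left left_diff_distrib mult_2 power_add)
  also have "\<dots> = prod ?f ((\<lambda>k. 2 * k) ` {1..n})"
    by (simp add: prod.reindex inj_on_def)
  also have "\<dots> = prod ?f ?E * prod ?f ?L"
    unfolding dbl by (intro prod.union_disjoint) auto
  finally have eq: "prod ?f ?E * (prod ?f ?O * (\<Prod>k\<in>{1..n}. 1 + fps_X ^ k)) =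
      prod ?f ?E * prod ?f ?L" .
  \<comment> \<open>The constant coefficient is 1. Over an integral domain the product over
    \<open>?E\<close> is then nonzero and can be cancelled.\<close>
  have "?f k \<noteq> 0" if "k > 0" for k
  proof
    assume "?f k = 0"
    then have "?f k $ 0 = 0" by simp
    then show False using that by (simp add: fps_X_power_nth)
  qed
  then have "prod ?f ?E \<noteq> 0" by simp
  then show ?thesis using eq by (rule mult_left_cancel[THEN iffD1])
qed

text \<open>All exponents on the right of \<open>euler_finite\<close> exceed \<open>n\<close>, so
  that product is 1 modulo q^(n+1).\<close>

lemma euler_mod:
  obtains Q :: "'r::idom fps" where
    "(\<Prod>k\<in>{k\<in>{1..n}. odd k}. 1 - fps_X ^ k) * (\<Prod>k\<in>{1..n}. 1 + fps_X ^ k) = 1 + fps_X ^ Suc n * Q"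
  using prod_one_minus_X_cong_one[of "{k\<in>{n<..2*n}. even k}" n]
  unfolding euler_finite by auto

section \<open>Two-color partitions and overpartitions\<close>

lemma part_le_sum_mset:
  fixes w :: "'a \<Rightarrow> nat"
  assumes "x \<in># p"
  shows "w x \<le> (\<Sum>x\<in>#p. w x)"
  using assms by (auto dest!: multi_member_split)

lemma prod_times_singleton: "(\<Prod>x\<in>A \<times> {c}. f x) = (\<Prod>a\<in>A. f (a, c))"
  by (rule prod.reindex_bij_witness[of _ "\<lambda>a. (a, c)" fst]) auto

text \<open>No part of a partition of \<open>n\<close> exceeds \<open>n\<close>, so the cutoff loses
  nothing and makes the set of available parts finite.\<close>

definition EE_parts :: "nat \<Rightarrow> (nat \<times> color) set" where
  "EE_parts n = {k\<in>{1..n}. odd k} \<times> {Red} \<union> {1..n} \<times> {Blue}"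

lemma EE_eq_part_msets: "EE n = part_msets fst (EE_parts n) {} n"
proof (intro equalityI subsetI)
  fix p assume p: "p \<in> EE n"
  have "x \<in> EE_parts n" if "x \<in># p" for x
    using that p part_le_sum_mset[OF that, of fst]
    by (cases x; cases "snd x") (auto simp: EE_parts_def EE_def two_color_partitions_def)
  with p show "p \<in> part_msets fst (EE_parts n) {} n"
    by (auto simp: EE_def two_color_partitions_def part_msets_def)
next
  fix p assume p: "p \<in> part_msets fst (EE_parts n) {} n"
  then have parts: "x \<in> EE_parts n" if "x \<in># p" for x
    using that by (auto simp: part_msets_def)
  have "count p x \<le> 1" for x
    using p parts by (cases "x \<in># p") (auto simp: part_msets_def not_in_iff)
  moreover have "fst x > 0 \<and> (even (fst x) \<longrightarrow> snd x = Blue)" if "x \<in># p" for x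
    using parts[OF that] by (auto simp: EE_parts_def)
  ultimately show "p \<in> EE n"
    using p by (auto simp: EE_def two_color_partitions_def part_msets_def)
qed

lemma finite_EE: "finite (EE n)"
  unfolding EE_eq_part_msets by (rule finite_part_msets) (auto simp: EE_parts_def)

lemma part_gf_EE_parts:
  "part_gf fst z (EE_parts n) {} =
    (\<Prod>k\<in>{k\<in>{1..n}. odd k}. 1 + fps_const (z (k, Red)) * fps_X ^ k) *
    (\<Prod>k\<in>{1..n}. 1 + fps_const (z (k, Blue)) * fps_X ^ k)"
proof -
  have "part_gf fst z (EE_parts n) {} * (\<Prod>x\<in>{}. 1 - fps_const (z x) * fps_X ^ fst x) =
      (\<Prod>x\<in>EE_parts n. 1 + fps_const (z x) * fps_X ^ fst x)"
    by (rule part_gf_product) (auto simp: EE_parts_def)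
  also have "\<dots> = (\<Prod>x\<in>{k\<in>{1..n}. odd k} \<times> {Red}. 1 + fps_const (z x) * fps_X ^ fst x) *
      (\<Prod>x\<in>{1..n} \<times> {Blue}. 1 + fps_const (z x) * fps_X ^ fst x)"
    unfolding EE_parts_def by (intro prod.union_disjoint) auto
  finally show ?thesis
    by (simp add: prod_times_singleton)
qed

text \<open>As a weight in \<open>part_gf\<close>, this turns the factor 1 + q^k of a red odd part
  into 1 - q^k, the shape that Euler's identity requires.\<close>

definition red_sign :: "nat \<times> color \<Rightarrow> int" where
  "red_sign x = (if odd (fst x) \<and> snd x = Red then - 1 else 1)"

lemma prod_mset_red_sign: "(\<Prod>x\<in>#p. red_sign x) = (- 1) ^ red_odd_parts p"
  by (induction p) (auto simp: red_odd_parts_def red_sign_def)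

lemma EE_split: "EE n = EE0 n \<union> EE1 n" "EE0 n \<inter> EE1 n = {}"
  by (auto simp: EE0_def EE1_def)

lemma part_gf_red_sign_nth: "part_gf fst red_sign (EE_parts n) {} $ n = int (E0 n) - int (E1 n)"
proof -
  have fin: "finite (EE0 n)" "finite (EE1 n)"
    using finite_EE[of n] by (auto simp: EE_split)
  have "part_gf fst red_sign (EE_parts n) {} $ n = (\<Sum>p\<in>EE n. (- 1) ^ red_odd_parts p)"
    by (simp add: part_gf_def prod_mset_red_sign flip: EE_eq_part_msets)
  also have "\<dots> = (\<Sum>p\<in>EE0 n. (- 1) ^ red_odd_parts p) + (\<Sum>p\<in>EE1 n. (- 1) ^ red_odd_parts p)"
    unfolding EE_split(1) using fin EE_split(2) by (rule sum.union_disjoint)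
  also have "(\<Sum>p\<in>EE0 n. (- 1) ^ red_odd_parts p) = (\<Sum>p\<in>EE0 n. 1 :: int)"
    by (intro sum.cong) (auto simp: EE0_def even_iff_mod_2_eq_zero)
  also have "(\<Sum>p\<in>EE1 n. (- 1) ^ red_odd_parts p) = (\<Sum>p\<in>EE1 n. - 1 :: int)"
    by (intro sum.cong) (auto simp: EE1_def odd_iff_mod_2_eq_one)
  finally show ?thesis by (simp add: E0_def E1_def)
qed

lemma part_gf_one_nth: "part_gf fst (\<lambda>_. 1) (EE_parts n) {} $ n = int (E0 n) + int (E1 n)"
proof -
  have "card (EE n) = E0 n + E1 n"
    using finite_EE[of n] EE_split(2)[of n]
    by (simp add: EE_split(1) card_Un_disjoint E0_def E1_def)
  then show ?thesis by (simp add: part_gf_def flip: EE_eq_part_msets)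
qed

lemma overpartitions_odd_eq_part_msets:
  "overpartitions_odd n =
    part_msets fst ({k\<in>{1..n}. odd k} \<times> {True}) ({k\<in>{1..n}. odd k} \<times> {False}) n"
  (is "_ = part_msets fst ?D ?U n")
proof (intro equalityI subsetI)
  fix p assume p: "p \<in> overpartitions_odd n"
  have "x \<in> ?D \<union> ?U" if "x \<in># p" for x
    using that p part_le_sum_mset[OF that, of fst]
    by (cases x) (auto simp: overpartitions_odd_def overpartitions_def)
  with p show "p \<in> part_msets fst ?D ?U n"
    by (auto simp: overpartitions_odd_def overpartitions_def part_msets_def)
next
  fix p assume p: "p \<in> part_msets fst ?D ?U n"
  then have parts: "x \<in> ?D \<union> ?U" if "x \<in># p" for x
    using that by (auto simp: part_msets_def)
  have "count p (k, True) \<le> 1" for k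
    using p parts[of "(k, True)"]
    by (cases "(k, True) \<in># p") (auto simp: part_msets_def not_in_iff)
  moreover have "fst x > 0 \<and> odd (fst x)" if "x \<in># p" for x
    using parts[OF that] by auto
  ultimately show "p \<in> overpartitions_odd n"
    using p by (auto simp: overpartitions_odd_def overpartitions_def part_msets_def)
qed

text \<open>The product formula for overpartitions into odd parts with its denominator cleared;
  \<open>n\<close> is both the cutoff and the coefficient read off.\<close>

lemma overpartitions_odd_gf:
  obtains G :: "int fps" where
    "G * (\<Prod>k\<in>{k\<in>{1..n}. odd k}. 1 - fps_X ^ k) = (\<Prod>k\<in>{k\<in>{1..n}. odd k}. 1 + fps_X ^ k)"
    "G $ n = int (p_bar_odd n)"
proof
  let ?O = "{k\<in>{1..n}. odd k}"
  let ?G = "part_gf fst (\<lambda>_. 1) (?O \<times> {True}) (?O \<times> {False}) :: int fps"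
  have "?G * (\<Prod>x\<in>?O \<times> {False}. 1 - fps_const 1 * fps_X ^ fst x) =
      (\<Prod>x\<in>?O \<times> {True}. 1 + fps_const 1 * fps_X ^ fst x)"
    by (rule part_gf_product) auto
  then show "?G * (\<Prod>k\<in>?O. 1 - fps_X ^ k) = (\<Prod>k\<in>?O. 1 + fps_X ^ k)"
    by (simp add: prod_times_singleton)
  show "?G $ n = int (p_bar_odd n)"
    by (simp add: part_gf_def p_bar_odd_def overpartitions_odd_eq_part_msets)
qed

theorem theorem1p11:
  fixes n :: nat
  assumes "n > 0"
  shows "E0 n = E1 n \<and> real (E1 n) = real (p_bar_odd n) / 2"
proof -
  let ?O = "{k\<in>{1..n}. odd k}"
  let ?B = "\<Prod>k\<in>{1..n}. 1 + fps_X ^ k :: int fps"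
  obtain Q :: "int fps" where Q: "(\<Prod>k\<in>?O. 1 - fps_X ^ k) * ?B = 1 + fps_X ^ Suc n * Q"
    by (rule euler_mod)
  obtain G :: "int fps" where
    G: "G * (\<Prod>k\<in>?O. 1 - fps_X ^ k) = (\<Prod>k\<in>?O. 1 + fps_X ^ k)" "G $ n = int (p_bar_odd n)"
    by (rule overpartitions_odd_gf)
  have "part_gf fst red_sign (EE_parts n) {} = (\<Prod>k\<in>?O. 1 - fps_X ^ k) * ?B"
    unfolding part_gf_EE_parts
    by (intro arg_cong2[of _ _ _ _ "(*)"] prod.cong)
      (auto simp: red_sign_def simp flip: fps_const_neg)
  then have "int (E0 n) - int (E1 n) = (1 + fps_X ^ Suc n * Q) $ n"
    by (simp only: Q flip: part_gf_red_sign_nth)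
  \<comment> \<open>At exponent \<open>n\<close> the multiple of q^(n+1) contributes nothing, and
    neither does the constant 1 since \<open>n > 0\<close>.\<close>
  then have diff: "E0 n = E1 n"
    using assms by (simp add: fps_X_power_mult_nth del: power_Suc)
  have "part_gf fst (\<lambda>_. 1) (EE_parts n) {} = (\<Prod>k\<in>?O. 1 + fps_X ^ k) * ?B"
    by (simp add: part_gf_EE_parts)
  \<comment> \<open>Trading the product of the 1 + q^k over odd k for \<open>G\<close> times that of
    the 1 - q^k brings in the left side of Euler's identity.\<close>
  also have "\<dots> = G * (1 + fps_X ^ Suc n * Q)"
    by (simp only: mult.assoc Q flip: G(1))
  also have "\<dots> = G + fps_X ^ Suc n * (G * Q)"
    by (simp add: algebra_simps del: power_Suc)
  finally have "int (E0 n) + int (E1 n) = int (p_bar_odd n)"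
    using part_gf_one_nth[of n] G(2) by (simp add: fps_X_power_mult_nth del: power_Suc)
  with diff show ?thesis by simp
qed

end
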